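(* Let $A,B$ be two Banach $*$-algebras and let $p$ be a self-adjoint element of $A$. Let $U=B(p,r)$ be an open ball centered at $p$, and let $D_p(A,B)$ be the set of all continuous functions $f:A\to B$ that are Fréchet differentiable on $U$ and satisfy $$\|f\|:=\max\left\{\sup_{x\in U}\|Df(x)\|,\ \sup_{a\in A}\|f(a)\|\right\}<\infty.$$ Then $D_p(A,B)$, with the pointwise operations, the involution $f^*(a)=(f(a^* ))^*$ $(a\in A)$, and the norm $\|\cdot\|$ above, is a Banach $*$-algebra.
   Context: A function $f:A\to B$ between normed spaces is Fréchet differentiable at $x\in A$ if there is a bounded linear map $u=Df(x):A\to B$ with $\lim_{h\to0}\|f(x+h)-f(x)-u(h)\|/\|h\|=0$. $\|Df(x)\|$ is the operator norm.
   Formalization: "Banach *-algebra" is taken with ‖xy‖ ≤ K‖x‖‖y‖ for some constant K instead of K = 1 (for A, B and D_p(A,B)), since the given norm is not submultiplicative: for A=B=ℂ, U the unit disc, f(z)=z/max(1,|z|) has ‖f‖=1 but ‖f²‖=2. *)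

theory Defs
  imports "HOL-Analysis.Analysis"
begin

text \<open>
  Complex Banach *-algebras, not necessarily unital, given by a carrier and explicit operations.
  As usual for a Banach *-algebra the involution is isometric.  Multiplication is required to be
  norm-continuous, i.e. to satisfy an estimate \<open>\<parallel>x y\<parallel> \<le> K \<parallel>x\<parallel> \<parallel>y\<parallel>\<close> for some constant \<open>K\<close>; the
  choice \<open>K = 1\<close> is not imposed, because the norm \<open>max (sup \<parallel>Df\<parallel>) (sup \<parallel>f\<parallel>)\<close> below is not
  submultiplicative: if \<open>f z = z / max 1 \<bar>z\<bar>\<close> on the complex plane and \<open>U\<close> is the open unit disc,
  then \<open>f\<close> has norm 1 and \<open>f \<cdot> f\<close> has norm 2.
\<close>

locale banach_star_algebra_on =
  fixes S :: "'a set"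
    and add :: "'a \<Rightarrow> 'a \<Rightarrow> 'a"
    and zero :: 'a
    and scale :: "complex \<Rightarrow> 'a \<Rightarrow> 'a"
    and mult :: "'a \<Rightarrow> 'a \<Rightarrow> 'a"
    and star :: "'a \<Rightarrow> 'a"
    and nrm :: "'a \<Rightarrow> real"
  assumes add_closed: "\<lbrakk>x \<in> S; y \<in> S\<rbrakk> \<Longrightarrow> add x y \<in> S"
    and zero_closed: "zero \<in> S"
    and scale_closed: "x \<in> S \<Longrightarrow> scale c x \<in> S"
    and mult_closed: "\<lbrakk>x \<in> S; y \<in> S\<rbrakk> \<Longrightarrow> mult x y \<in> S"
    and star_closed: "x \<in> S \<Longrightarrow> star x \<in> S"
    and add_assoc: "\<lbrakk>x \<in> S; y \<in> S; z \<in> S\<rbrakk> \<Longrightarrow> add (add x y) z = add x (add y z)"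
    and add_commute: "\<lbrakk>x \<in> S; y \<in> S\<rbrakk> \<Longrightarrow> add x y = add y x"
    and add_zero: "x \<in> S \<Longrightarrow> add x zero = x"
    and add_inverse: "x \<in> S \<Longrightarrow> \<exists>y\<in>S. add x y = zero"
    and scale_add_right: "\<lbrakk>x \<in> S; y \<in> S\<rbrakk> \<Longrightarrow> scale c (add x y) = add (scale c x) (scale c y)"
    and scale_add_left: "x \<in> S \<Longrightarrow> scale (c + d) x = add (scale c x) (scale d x)"
    and scale_scale: "x \<in> S \<Longrightarrow> scale c (scale d x) = scale (c * d) x"
    and scale_one: "x \<in> S \<Longrightarrow> scale 1 x = x"
    and mult_assoc: "\<lbrakk>x \<in> S; y \<in> S; z \<in> S\<rbrakk> \<Longrightarrow> mult (mult x y) z = mult x (mult y z)"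
    and mult_add_left: "\<lbrakk>x \<in> S; y \<in> S; z \<in> S\<rbrakk> \<Longrightarrow> mult (add x y) z = add (mult x z) (mult y z)"
    and mult_add_right: "\<lbrakk>x \<in> S; y \<in> S; z \<in> S\<rbrakk> \<Longrightarrow> mult x (add y z) = add (mult x y) (mult x z)"
    and mult_scale_left: "\<lbrakk>x \<in> S; y \<in> S\<rbrakk> \<Longrightarrow> mult (scale c x) y = scale c (mult x y)"
    and mult_scale_right: "\<lbrakk>x \<in> S; y \<in> S\<rbrakk> \<Longrightarrow> mult x (scale c y) = scale c (mult x y)"
    and star_star: "x \<in> S \<Longrightarrow> star (star x) = x"
    and star_add: "\<lbrakk>x \<in> S; y \<in> S\<rbrakk> \<Longrightarrow> star (add x y) = add (star x) (star y)"
    and star_scale: "x \<in> S \<Longrightarrow> star (scale c x) = scale (cnj c) (star x)"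
    and star_mult: "\<lbrakk>x \<in> S; y \<in> S\<rbrakk> \<Longrightarrow> star (mult x y) = mult (star y) (star x)"
    and nrm_eq_zero_iff: "x \<in> S \<Longrightarrow> nrm x = 0 \<longleftrightarrow> x = zero"
    and nrm_triangle: "\<lbrakk>x \<in> S; y \<in> S\<rbrakk> \<Longrightarrow> nrm (add x y) \<le> nrm x + nrm y"
    and nrm_scale: "x \<in> S \<Longrightarrow> nrm (scale c x) = cmod c * nrm x"
    and nrm_mult_bounded: "\<exists>K. \<forall>x\<in>S. \<forall>y\<in>S. nrm (mult x y) \<le> K * nrm x * nrm y"
    and nrm_star: "x \<in> S \<Longrightarrow> nrm (star x) = nrm x"
    and nrm_complete: "\<And>X :: nat \<Rightarrow> 'a.
      \<lbrakk>\<And>n. X n \<in> S;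
       \<And>e. e > 0 \<Longrightarrow> \<exists>N. \<forall>m\<ge>N. \<forall>n\<ge>N. nrm (add (X m) (scale (-1) (X n))) < e\<rbrakk>
      \<Longrightarrow> \<exists>x\<in>S. (\<lambda>n. nrm (add (X n) (scale (-1) x))) \<longlonglongrightarrow> 0"

text \<open>
  The same notion for a whole type.  The real scalar multiplication of \<open>real_normed_vector\<close> is
  the restriction of the complex one, so that the library's topology, derivatives and operator
  norm apply.
\<close>

class banach_star_algebra = real_normed_vector + ring +
  fixes scaleC :: "complex \<Rightarrow> 'a \<Rightarrow> 'a"
    and star :: "'a \<Rightarrow> 'a"
  assumes scaleR_eq_scaleC: "scaleR t x = scaleC (complex_of_real t) x"
    and banach_star_algebra_on_UNIV: "banach_star_algebra_on UNIV (+) 0 scaleC (*) star norm"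

text \<open>
  \<open>has_derivative\<close> provides a bounded real-linear map; between complex spaces the derivative has
  to be complex-linear.
\<close>

definition complex_frechet_differentiable_at ::
    "('a::banach_star_algebra \<Rightarrow> 'b::banach_star_algebra) \<Rightarrow> 'a \<Rightarrow> bool" where
  "complex_frechet_differentiable_at f x \<longleftrightarrow>
    (\<exists>u. (f has_derivative u) (at x) \<and> (\<forall>c h. u (scaleC c h) = scaleC c (u h)))"

text \<open>
  Finiteness of the two suprema is expressed by boundedness; on such functions the real-valued
  suprema in \<open>Dp_norm\<close> are the true ones.
\<close>

definition Dp :: "'a \<Rightarrow> real \<Rightarrow> ('a::banach_star_algebra \<Rightarrow> 'b::banach_star_algebra) set" where
  "Dp p r = {f. continuous_on UNIV f \<and>
                (\<forall>x \<in> ball p r. complex_frechet_differentiable_at f x) \<and>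
                bdd_above ((\<lambda>x. onorm (frechet_derivative f (at x))) ` ball p r) \<and>
                bdd_above (range (\<lambda>a. norm (f a)))}"

definition Dp_norm ::
    "'a \<Rightarrow> real \<Rightarrow> ('a::banach_star_algebra \<Rightarrow> 'b::banach_star_algebra) \<Rightarrow> real" where
  "Dp_norm p r f = max (SUP x \<in> ball p r. onorm (frechet_derivative f (at x))) (SUP a. norm (f a))"

end

theory Submission
  imports Defs
begin

text \<open>
  A function \<open>f\<close> lies in \<open>Dp p r\<close> with norm at most \<open>M\<close> iff \<open>M\<close> bounds \<open>f\<close> and is a Lipschitz
  constant of its complex-linear derivatives on the ball.  In this form closure and the norm
  estimates reduce to the rules of differentiation; the involution preserves the ball since
  \<open>p\<close> is self-adjoint and \<open>star\<close> is isometric.  For completeness, a Cauchy sequence and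
  its derivatives converge uniformly, so the limit of the derivatives is the derivative of the limit.
\<close>

section \<open>Operations of a Banach star-algebra as bounded maps\<close>

lemmas star_algebra_simps =
  banach_star_algebra_on.scale_add_right [OF banach_star_algebra_on_UNIV, simplified]
  banach_star_algebra_on.scale_add_left [OF banach_star_algebra_on_UNIV, simplified]
  banach_star_algebra_on.scale_scale [OF banach_star_algebra_on_UNIV, simplified]
  banach_star_algebra_on.scale_one [OF banach_star_algebra_on_UNIV, simplified]
  banach_star_algebra_on.mult_scale_left [OF banach_star_algebra_on_UNIV, simplified]
  banach_star_algebra_on.mult_scale_right [OF banach_star_algebra_on_UNIV, simplified]
  banach_star_algebra_on.star_star [OF banach_star_algebra_on_UNIV, simplified]
  banach_star_algebra_on.star_add [OF banach_star_algebra_on_UNIV, simplified]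
  banach_star_algebra_on.star_scale [OF banach_star_algebra_on_UNIV, simplified]
  banach_star_algebra_on.star_mult [OF banach_star_algebra_on_UNIV, simplified]
  banach_star_algebra_on.nrm_scale [OF banach_star_algebra_on_UNIV, simplified]
  banach_star_algebra_on.nrm_star [OF banach_star_algebra_on_UNIV, simplified]

text \<open>The locale forms differences through \<open>scale (-1)\<close>; this rewriting turns
  them into library subtraction.\<close>

lemma scaleC_minus_one: "scaleC (- 1) x = - (x :: 'a::banach_star_algebra)"
  using scaleR_eq_scaleC [of "- 1" x] by simp

lemma bounded_linear_scaleC: "bounded_linear (scaleC c :: 'a::banach_star_algebra \<Rightarrow> 'a)"
  by (rule bounded_linear_intro [where K = "cmod c"])
    (simp_all add: star_algebra_simps scaleR_eq_scaleC mult.commute)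

text \<open>Conjugate-linear over the complex numbers, hence linear over the reals, as
  \<open>bounded_linear\<close> requires.\<close>

lemma bounded_linear_star: "bounded_linear (star :: 'a::banach_star_algebra \<Rightarrow> 'a)"
  by (rule bounded_linear_intro [where K = 1])
    (simp_all add: star_algebra_simps scaleR_eq_scaleC)

text \<open>The axiom gives a constant of unknown sign; passing to \<open>max 0 K\<close> allows
  monotonicity arguments in the product estimates.\<close>

lemma norm_mult_bounded:
  obtains K where "0 \<le> K" "\<And>x y :: 'a::banach_star_algebra. norm (x * y) \<le> K * norm x * norm y"
proof -
  obtain K where K: "norm (x * y) \<le> K * norm x * norm y" for x y :: 'a
    using banach_star_algebra_on.nrm_mult_bounded
      [OF banach_star_algebra_on_UNIV [where 'a = 'a]] by auto
  have "norm (x * y) \<le> max 0 K * norm x * norm y" for x y :: 'a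
    using K [of x y] by (smt (verit) mult_right_mono norm_ge_zero)
  then show thesis
    using that [of "max 0 K"] by simp
qed

lemma bounded_bilinear_mult:
  "bounded_bilinear ((*) :: 'a::banach_star_algebra \<Rightarrow> 'a \<Rightarrow> 'a)"
proof -
  obtain K where "0 \<le> K" "\<And>x y :: 'a. norm (x * y) \<le> K * norm x * norm y"
    by (rule norm_mult_bounded) blast
  then have "\<exists>K. \<forall>x y :: 'a. norm (x * y) \<le> norm x * norm y * K"
    by (metis mult.assoc mult.commute)
  then show ?thesis
    by (unfold_locales)
      (simp_all add: star_algebra_simps scaleR_eq_scaleC distrib_left distrib_right)
qed

text \<open>Translates the completeness axiom, which is stated with explicit operations, so that
  library results about Banach spaces apply to the codomain.\<close>

instance banach_star_algebra \<subseteq> complete_space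
proof
  fix X :: "nat \<Rightarrow> 'a"
  assume "Cauchy X"
  then have "\<exists>N. \<forall>m\<ge>N. \<forall>n\<ge>N. norm (X m + scaleC (- 1) (X n)) < e" if "e > 0" for e
    using that by (simp add: Cauchy_def dist_norm scaleC_minus_one)
  then obtain x where "(\<lambda>n. norm (X n + scaleC (- 1) x)) \<longlonglongrightarrow> 0"
    using banach_star_algebra_on.nrm_complete
      [OF banach_star_algebra_on_UNIV [where 'a = 'a], of X] by auto
  then show "convergent X"
    by (auto simp: scaleC_minus_one tendsto_norm_zero_iff convergent_def intro: Lim_transform
        LIM_zero_cancel)
qed

instance banach_star_algebra \<subseteq> banach ..

section \<open>Membership and norm bound as one condition\<close>

text \<open>An existential derivative with a pointwise estimate replaces
  \<open>frechet_derivative\<close>, \<open>onorm\<close> and both suprema, so each operation only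
  has to exhibit a derivative and estimate it.\<close>

definition Dp_bounded ::
    "'a \<Rightarrow> real \<Rightarrow> real \<Rightarrow> ('a::banach_star_algebra \<Rightarrow> 'b::banach_star_algebra) \<Rightarrow> bool" where
  "Dp_bounded p r M f \<longleftrightarrow>
    continuous_on UNIV f \<and> (\<forall>a. norm (f a) \<le> M) \<and>
    (\<forall>x \<in> ball p r. \<exists>u. (f has_derivative u) (at x) \<and>
      (\<forall>c h. u (scaleC c h) = scaleC c (u h)) \<and> (\<forall>h. norm (u h) \<le> M * norm h))"

lemma Dp_bounded_nonneg: "Dp_bounded p r M f \<Longrightarrow> 0 \<le> M"
  unfolding Dp_bounded_def using norm_ge_zero order_trans by blast

text \<open>By uniqueness of derivatives every witness \<open>u\<close> equals
  \<open>frechet_derivative f (at x)\<close>. For such a \<open>u\<close> and nonnegative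
  \<open>M\<close>, the pointwise estimate amounts to \<open>onorm u \<le> M\<close>.\<close>

lemma Dp_bounded_iff:
  assumes "r > 0"
  shows "Dp_bounded p r M f \<longleftrightarrow> f \<in> Dp p r \<and> Dp_norm p r f \<le> M"
proof
  assume f: "Dp_bounded p r M f"
  then have M: "0 \<le> M"
    by (rule Dp_bounded_nonneg)
  have le: "onorm (frechet_derivative f (at x)) \<le> M" if x: "x \<in> ball p r" for x
  proof -
    obtain u where u: "(f has_derivative u) (at x)" "\<And>h. norm (u h) \<le> M * norm h"
      using f x unfolding Dp_bounded_def by blast
    show ?thesis
      using onorm_bound [OF M u(2)] frechet_derivative_at [OF u(1)] by simp
  qed
  have "f \<in> Dp p r"
    using f le unfolding Dp_def Dp_bounded_def complex_frechet_differentiable_at_def bdd_above_def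
    by blast
  \<comment> \<open>Since \<open>r > 0\<close>, the ball is nonempty, as \<open>cSUP_least\<close>
    demands; a real supremum over the empty set would carry no information.\<close>
  moreover have "(SUP x \<in> ball p r. onorm (frechet_derivative f (at x))) \<le> M"
    using assms le by (intro cSUP_least) auto
  moreover have "(SUP a. norm (f a)) \<le> M"
    using f unfolding Dp_bounded_def by (intro cSUP_least) auto
  ultimately show "f \<in> Dp p r \<and> Dp_norm p r f \<le> M"
    by (simp add: Dp_norm_def)
next
  assume f: "f \<in> Dp p r \<and> Dp_norm p r f \<le> M"
  have "norm (f a) \<le> M" for a
  proof -
    have "norm (f a) \<le> (SUP a. norm (f a))"
      using f by (intro cSUP_upper) (auto simp: Dp_def)
    then show ?thesis
      using f by (simp add: Dp_norm_def)
  qed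
  moreover have "\<exists>u. (f has_derivative u) (at x) \<and>
      (\<forall>c h. u (scaleC c h) = scaleC c (u h)) \<and> (\<forall>h. norm (u h) \<le> M * norm h)"
    if x: "x \<in> ball p r" for x
  proof -
    obtain u where u: "(f has_derivative u) (at x)" "\<And>c h. u (scaleC c h) = scaleC c (u h)"
      using f x unfolding Dp_def complex_frechet_differentiable_at_def by blast
    have "onorm (frechet_derivative f (at x)) \<le> (SUP x \<in> ball p r. onorm (frechet_derivative f (at x)))"
      using f x by (intro cSUP_upper) (auto simp: Dp_def)
    then have "onorm u \<le> M"
      using f frechet_derivative_at [OF u(1)] by (simp add: Dp_norm_def)
    then have "norm (u h) \<le> M * norm h" for h
      using onorm [OF has_derivative_bounded_linear [OF u(1)], of h]
      by (meson mult_right_mono norm_ge_zero order_trans)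
    with u show ?thesis
      by blast
  qed
  ultimately show "Dp_bounded p r M f"
    using f unfolding Dp_bounded_def Dp_def by simp
qed

section \<open>Closure under the operations, with explicit bounds\<close>

lemma Dp_bounded_zero: "Dp_bounded p r 0 (\<lambda>a. 0)"
proof -
  have "scaleC c 0 = (0 :: 'c::banach_star_algebra)" for c
    by (rule linear_0 [OF bounded_linear.linear [OF bounded_linear_scaleC]])
  then show ?thesis
    by (auto simp: Dp_bounded_def intro!: exI [of _ "\<lambda>_. 0"])
qed

lemma Dp_bounded_add:
  assumes "Dp_bounded p r M f" "Dp_bounded p r N g"
  shows "Dp_bounded p r (M + N) (\<lambda>a. f a + g a)"
  unfolding Dp_bounded_def
proof (intro conjI allI ballI)
  show "continuous_on UNIV (\<lambda>a. f a + g a)"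
    using assms by (auto simp: Dp_bounded_def intro: continuous_on_add)
  show "norm (f a + g a) \<le> M + N" for a
    using assms by (auto simp: Dp_bounded_def intro: norm_triangle_mono)
  fix x assume "x \<in> ball p r"
  then obtain u v
    where u: "(f has_derivative u) (at x)" "\<And>c h. u (scaleC c h) = scaleC c (u h)"
        "\<And>h. norm (u h) \<le> M * norm h"
      and v: "(g has_derivative v) (at x)" "\<And>c h. v (scaleC c h) = scaleC c (v h)"
        "\<And>h. norm (v h) \<le> N * norm h"
    using assms unfolding Dp_bounded_def by metis
  show "\<exists>u. ((\<lambda>a. f a + g a) has_derivative u) (at x) \<and>
      (\<forall>c h. u (scaleC c h) = scaleC c (u h)) \<and> (\<forall>h. norm (u h) \<le> (M + N) * norm h)"
  proof (intro exI conjI allI)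
    show "((\<lambda>a. f a + g a) has_derivative (\<lambda>h. u h + v h)) (at x)"
      by (rule has_derivative_add [OF u(1) v(1)])
    show "u (scaleC c h) + v (scaleC c h) = scaleC c (u h + v h)" for c h
      by (simp add: u v star_algebra_simps)
    show "norm (u h + v h) \<le> (M + N) * norm h" for h
      using norm_triangle_mono [OF u(3) v(3), of h h] by (simp add: distrib_right)
  qed
qed

lemma Dp_bounded_scaleC:
  assumes "Dp_bounded p r M f"
  shows "Dp_bounded p r (cmod c * M) (\<lambda>a. scaleC c (f a))"
  unfolding Dp_bounded_def
proof (intro conjI allI ballI)
  show "continuous_on UNIV (\<lambda>a. scaleC c (f a))"
    using assms
    by (auto simp: Dp_bounded_def intro: bounded_linear.continuous_on [OF bounded_linear_scaleC])
  show "norm (scaleC c (f a)) \<le> cmod c * M" for a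
    using assms by (simp add: Dp_bounded_def star_algebra_simps mult_left_mono)
  fix x assume "x \<in> ball p r"
  then obtain u
    where u: "(f has_derivative u) (at x)" "\<And>c h. u (scaleC c h) = scaleC c (u h)"
        "\<And>h. norm (u h) \<le> M * norm h"
    using assms unfolding Dp_bounded_def by metis
  show "\<exists>u. ((\<lambda>a. scaleC c (f a)) has_derivative u) (at x) \<and>
      (\<forall>d h. u (scaleC d h) = scaleC d (u h)) \<and> (\<forall>h. norm (u h) \<le> cmod c * M * norm h)"
  proof (intro exI conjI allI)
    show "((\<lambda>a. scaleC c (f a)) has_derivative (\<lambda>h. scaleC c (u h))) (at x)"
      by (rule bounded_linear.has_derivative [OF bounded_linear_scaleC u(1)])
    show "scaleC c (u (scaleC d h)) = scaleC d (scaleC c (u h))" for d h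
      by (simp add: u star_algebra_simps mult.commute)
    show "norm (scaleC c (u h)) \<le> cmod c * M * norm h" for h
      by (simp add: u star_algebra_simps mult_left_mono mult.assoc)
  qed
qed

text \<open>The product rule yields two summands, each at most \<open>K * M * N * norm h\<close>,
  whence the factor 2. The order of the factors is kept because the algebra need not be
  commutative.\<close>

lemma Dp_bounded_mult:
  assumes "Dp_bounded p r M f" "Dp_bounded p r N g"
    and K: "0 \<le> K" "\<And>x y :: 'b::banach_star_algebra. norm (x * y) \<le> K * norm x * norm y"
  shows "Dp_bounded p r (2 * K * M * N) (\<lambda>a. f a * g a :: 'b)"
  unfolding Dp_bounded_def
proof (intro conjI allI ballI)
  have M: "0 \<le> M" and N: "0 \<le> N"
    using assms Dp_bounded_nonneg by blast+
  have norm_mult_le: "norm (x * y) \<le> K * s * t" if "norm x \<le> s" "norm y \<le> t" for x y :: 'b and s t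
  proof -
    have "K * norm x * norm y \<le> K * s * t"
      using that K(1) order_trans [OF norm_ge_zero that(1)] by (intro mult_mono) auto
    then show ?thesis
      using K(2) order_trans by blast
  qed
  show "continuous_on UNIV (\<lambda>a. f a * g a)"
    using assms
    by (auto simp: Dp_bounded_def intro: bounded_bilinear.continuous_on [OF bounded_bilinear_mult])
  show "norm (f a * g a) \<le> 2 * K * M * N" for a
  proof -
    have "norm (f a * g a) \<le> K * M * N"
      using assms by (intro norm_mult_le) (auto simp: Dp_bounded_def)
    moreover have "0 \<le> K * M * N"
      using K M N by simp
    ultimately show ?thesis
      by linarith
  qed
  fix x assume "x \<in> ball p r"
  then obtain u v
    where u: "(f has_derivative u) (at x)" "\<And>c h. u (scaleC c h) = scaleC c (u h)"
        "\<And>h. norm (u h) \<le> M * norm h"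
      and v: "(g has_derivative v) (at x)" "\<And>c h. v (scaleC c h) = scaleC c (v h)"
        "\<And>h. norm (v h) \<le> N * norm h"
    using assms unfolding Dp_bounded_def by metis
  show "\<exists>u. ((\<lambda>a. f a * g a) has_derivative u) (at x) \<and>
      (\<forall>c h. u (scaleC c h) = scaleC c (u h)) \<and> (\<forall>h. norm (u h) \<le> 2 * K * M * N * norm h)"
  proof (intro exI conjI allI)
    show "((\<lambda>a. f a * g a) has_derivative (\<lambda>h. f x * v h + u h * g x)) (at x)"
      by (rule bounded_bilinear.FDERIV [OF bounded_bilinear_mult u(1) v(1)])
    show "f x * v (scaleC c h) + u (scaleC c h) * g x = scaleC c (f x * v h + u h * g x)" for c h
      by (simp add: u v star_algebra_simps)
    show "norm (f x * v h + u h * g x) \<le> 2 * K * M * N * norm h" for h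
    proof -
      have "norm (f x * v h) \<le> K * M * (N * norm h)" "norm (u h * g x) \<le> K * (M * norm h) * N"
        using assms u v by (intro norm_mult_le; auto simp: Dp_bounded_def)+
      then have "norm (f x * v h + u h * g x) \<le> K * M * (N * norm h) + K * (M * norm h) * N"
        by (rule norm_triangle_mono)
      then show ?thesis
        by (simp add: algebra_simps)
    qed
  qed
qed

text \<open>The chain rule over the reals gives the derivative \<open>star (u (star h))\<close>. The
  two conjugations of the scalar cancel, so it is again complex-linear, and isometry of
  \<open>star\<close> preserves the bound.\<close>

lemma Dp_bounded_star:
  assumes f: "Dp_bounded p r M f" and p: "star p = p"
  shows "Dp_bounded p r M (\<lambda>a. star (f (star a)))"
  unfolding Dp_bounded_def
proof (intro conjI allI ballI)
  have "continuous_on UNIV (star :: 'a \<Rightarrow> 'a)"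
    using bounded_linear_star linear_continuous_on by blast
  then have "continuous_on UNIV (\<lambda>a. f (star a))"
    using f by (auto simp: Dp_bounded_def intro: continuous_on_compose2)
  then show "continuous_on UNIV (\<lambda>a. star (f (star a)))"
    by (rule bounded_linear.continuous_on [OF bounded_linear_star])
  show "norm (star (f (star a))) \<le> M" for a
    using f by (simp add: Dp_bounded_def star_algebra_simps)
  fix x assume "x \<in> ball p r"
  moreover have "dist p (star x) = dist p x"
  proof -
    have "star (p - x) = p - star x"
      by (simp add: linear_diff [OF bounded_linear.linear [OF bounded_linear_star]] p)
    then show ?thesis
      using star_algebra_simps(12) [of "p - x"] by (simp add: dist_norm)
  qed
  ultimately obtain u
    where u: "(f has_derivative u) (at (star x))" "\<And>c h. u (scaleC c h) = scaleC c (u h)"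
        "\<And>h. norm (u h) \<le> M * norm h"
    using f unfolding Dp_bounded_def by (metis mem_ball)
  show "\<exists>u. ((\<lambda>a. star (f (star a))) has_derivative u) (at x) \<and>
      (\<forall>c h. u (scaleC c h) = scaleC c (u h)) \<and> (\<forall>h. norm (u h) \<le> M * norm h)"
  proof (intro exI conjI allI)
    show "((\<lambda>a. star (f (star a))) has_derivative (\<lambda>h. star (u (star h)))) (at x)"
      by (rule bounded_linear.has_derivative [OF bounded_linear_star],
          rule has_derivative_compose [where g = f,
            OF bounded_linear_imp_has_derivative [OF bounded_linear_star]], rule u(1))
    show "star (u (star (scaleC c h))) = scaleC c (star (u (star h)))" for c h
      by (simp add: u star_algebra_simps)
    show "norm (star (u (star h))) \<le> M * norm h" for h
      using u(3) [of "star h"] by (simp add: star_algebra_simps)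
  qed
qed

lemma Dp_bounded_diff:
  assumes "Dp_bounded p r M f" "Dp_bounded p r N g"
  shows "Dp_bounded p r (M + N) (\<lambda>a. f a - g a)"
  using Dp_bounded_add [OF assms(1) Dp_bounded_scaleC [OF assms(2), of "- 1"]]
  by (simp add: scaleC_minus_one)

section \<open>Completeness\<close>

text \<open>The weight \<open>w\<close> lets one argument serve twice: it is constantly 1 for the
  functions and the norm of the direction for their derivatives.\<close>

lemma uniform_Cauchy_limit:
  fixes F :: "nat \<Rightarrow> 'a \<Rightarrow> 'b::banach" and w :: "'a \<Rightarrow> real"
  assumes "\<And>e. e > 0 \<Longrightarrow> \<exists>N. \<forall>m\<ge>N. \<forall>n\<ge>N. \<forall>x\<in>S. norm (F m x - F n x) \<le> e * w x"
  obtains L where "\<And>x. x \<in> S \<Longrightarrow> (\<lambda>n. F n x) \<longlonglongrightarrow> L x"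
    "\<And>e. e > 0 \<Longrightarrow> \<exists>N. \<forall>n\<ge>N. \<forall>x\<in>S. norm (F n x - L x) \<le> e * w x"
proof -
  have "convergent (\<lambda>n. F n x)" if x: "x \<in> S" for x
  proof (rule Cauchy_convergent, rule CauchyI)
    fix e :: real assume "e > 0"
    \<comment> \<open>No sign is assumed for \<open>w x\<close>; the absolute value and the added 1
      keep the denominator positive while giving \<open>d * w x \<le> e / 2\<close>.\<close>
    define d where "d = e / (2 * (\<bar>w x\<bar> + 1))"
    have d: "d > 0"
      unfolding d_def using \<open>e > 0\<close> by (intro divide_pos_pos) auto
    have "d * w x \<le> d * (\<bar>w x\<bar> + 1)"
      using d by (intro mult_left_mono) auto
    also have "\<dots> = e / 2"
      unfolding d_def by (simp add: field_simps)
    finally have "d * w x < e"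
      using \<open>e > 0\<close> by simp
    then show "\<exists>N. \<forall>m\<ge>N. \<forall>n\<ge>N. norm (F m x - F n x) < e"
      using assms [OF d] x by (meson order_le_less_trans)
  qed
  then have L: "(\<lambda>n. F n x) \<longlonglongrightarrow> lim (\<lambda>n. F n x)" if "x \<in> S" for x
    using that convergent_LIMSEQ_iff by blast
  have "\<exists>N. \<forall>n\<ge>N. \<forall>x\<in>S. norm (F n x - lim (\<lambda>n. F n x)) \<le> e * w x" if "e > 0" for e
  proof -
    obtain N where N: "\<And>m n x. m \<ge> N \<Longrightarrow> n \<ge> N \<Longrightarrow> x \<in> S \<Longrightarrow> norm (F m x - F n x) \<le> e * w x"
      using assms [OF \<open>e > 0\<close>] by blast
    \<comment> \<open>With \<open>n\<close> and \<open>x\<close> fixed, the Cauchy estimate passes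
      to the limit in \<open>m\<close>; \<open>N\<close> does not depend on \<open>x\<close>, so
      uniformity survives.\<close>
    have "norm (F n x - lim (\<lambda>n. F n x)) \<le> e * w x" if "n \<ge> N" "x \<in> S" for n x
    proof (rule Lim_bounded)
      show "(\<lambda>m. norm (F n x - F m x)) \<longlonglongrightarrow> norm (F n x - lim (\<lambda>n. F n x))"
        by (intro tendsto_norm tendsto_diff tendsto_const L that)
      show "\<forall>m\<ge>N. norm (F n x - F m x) \<le> e * w x"
        using N that by blast
    qed
    then show ?thesis
      by blast
  qed
  with L show thesis
    by (rule that)
qed

text \<open>Estimating the difference \<open>X n - g\<close> suffices: small \<open>e\<close> gives
  convergence, and a single \<open>e\<close> already puts \<open>g\<close> into the space.\<close>

lemma Dp_bounded_complete:
  fixes X :: "nat \<Rightarrow> 'a::banach_star_algebra \<Rightarrow> 'b::banach_star_algebra"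
  assumes "r > 0" and X: "\<And>n. X n \<in> Dp p r"
    and Cauchy: "\<And>e. e > 0 \<Longrightarrow> \<exists>N. \<forall>m\<ge>N. \<forall>n\<ge>N. Dp_bounded p r e (\<lambda>a. X m a - X n a)"
  obtains g where "\<And>e. e > 0 \<Longrightarrow> \<exists>N. \<forall>n\<ge>N. Dp_bounded p r e (\<lambda>a. X n a - g a)"
proof -
  have "\<exists>N. \<forall>m\<ge>N. \<forall>n\<ge>N. \<forall>a\<in>UNIV. norm (X m a - X n a) \<le> e * 1" if "e > 0" for e
    using Cauchy [OF that] unfolding Dp_bounded_def by auto
  then obtain g where lim: "\<And>a. (\<lambda>n. X n a) \<longlonglongrightarrow> g a"
    and unif: "\<And>e. e > 0 \<Longrightarrow> \<exists>N. \<forall>n\<ge>N. \<forall>a. norm (X n a - g a) \<le> e"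
    by (rule uniform_Cauchy_limit [where S = UNIV and w = "\<lambda>_. 1"]) auto
  have cont: "continuous_on UNIV (X n)" for n
    using X by (auto simp: Dp_def)
  have "uniform_limit UNIV X g sequentially"
    unfolding uniform_limit_sequentially_iff dist_norm
  proof (intro allI impI)
    fix e :: real assume "e > 0"
    \<comment> \<open>Half of \<open>e\<close> makes room for the strict inequality in
      \<open>uniform_limit\<close>.\<close>
    then obtain N where "\<And>n a. n \<ge> N \<Longrightarrow> norm (X n a - g a) \<le> e / 2"
      using unif [of "e / 2"] by auto
    then have "norm (X n a - g a) < e" if "n \<ge> N" for n a
      using that \<open>e > 0\<close> by (smt (verit) field_sum_of_halves)
    then show "\<exists>N. \<forall>n\<ge>N. \<forall>a\<in>UNIV. norm (X n a - g a) < e"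
      by blast
  qed
  then have cont_g: "continuous_on UNIV g"
    using cont by (intro uniform_limit_theorem [where F = sequentially and f = X]) auto
  obtain D where D: "\<And>n x. x \<in> ball p r \<Longrightarrow> (X n has_derivative D n x) (at x)"
    and Dscale: "\<And>n x c h. x \<in> ball p r \<Longrightarrow> D n x (scaleC c h) = scaleC c (D n x h)"
    using X unfolding Dp_def complex_frechet_differentiable_at_def mem_Collect_eq by metis
  \<comment> \<open>Base point and direction form a pair \<open>z\<close>, so that the Cauchy
    estimate is uniform in the base point and linear in the norm of the direction.\<close>
  have "\<exists>N. \<forall>m\<ge>N. \<forall>n\<ge>N. \<forall>z\<in>ball p r \<times> UNIV.
      norm (case_prod (D m) z - case_prod (D n) z) \<le> e * norm (snd z)" if "e > 0" for e
  proof -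
    obtain N where N: "\<And>m n. m \<ge> N \<Longrightarrow> n \<ge> N \<Longrightarrow> Dp_bounded p r e (\<lambda>a. X m a - X n a)"
      using Cauchy [OF \<open>e > 0\<close>] by blast
    have "norm (D m x h - D n x h) \<le> e * norm h"
      if mn: "m \<ge> N" "n \<ge> N" and x: "x \<in> ball p r" for m n x h
    proof -
      obtain u where u: "((\<lambda>a. X m a - X n a) has_derivative u) (at x)"
          "\<And>h. norm (u h) \<le> e * norm h"
        using N [OF mn] x unfolding Dp_bounded_def by blast
      \<comment> \<open>Uniqueness of derivatives transfers the bound on the derivative of
        \<open>X m - X n\<close> to the chosen \<open>D m x\<close> and
        \<open>D n x\<close>.\<close>
      have "u = (\<lambda>h. D m x h - D n x h)"
        by (rule has_derivative_unique [OF u(1) has_derivative_diff [OF D D]]) (rule x)+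
      with u(2) show ?thesis
        by simp
    qed
    then show ?thesis
      by (intro exI [of _ N]) auto
  qed
  then obtain L where Llim: "\<And>z. z \<in> ball p r \<times> UNIV \<Longrightarrow> (\<lambda>n. case_prod (D n) z) \<longlonglongrightarrow> L z"
    and Lunif: "\<And>e. e > 0 \<Longrightarrow>
      \<exists>N. \<forall>n\<ge>N. \<forall>z\<in>ball p r \<times> UNIV. norm (case_prod (D n) z - L z) \<le> e * norm (snd z)"
    by (rule uniform_Cauchy_limit
        [where S = "ball p r \<times> UNIV" and F = "\<lambda>n. case_prod (D n)" and w = "\<lambda>z. norm (snd z)"]) blast+
  define u where "u = curry L"
  have ulim: "(\<lambda>n. D n x h) \<longlonglongrightarrow> u x h" if "x \<in> ball p r" for x h
    using Llim [of "(x, h)"] that by (simp add: u_def)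
  have uunif: "\<exists>N. \<forall>n\<ge>N. \<forall>x\<in>ball p r. \<forall>h. norm (D n x h - u x h) \<le> e * norm h" if "e > 0" for e
    using Lunif [OF that] by (simp add: u_def)
  \<comment> \<open>Complex homogeneity passes to the limit by continuity of \<open>scaleC\<close>;
    real linearity and boundedness of \<open>u x\<close> come with
    \<open>has_derivative_sequence\<close> below.\<close>
  have uscale: "u x (scaleC c h) = scaleC c (u x h)" if x: "x \<in> ball p r" for x c h
  proof (rule LIMSEQ_unique)
    show "(\<lambda>n. D n x (scaleC c h)) \<longlonglongrightarrow> u x (scaleC c h)"
      by (rule ulim [OF x])
    show "(\<lambda>n. D n x (scaleC c h)) \<longlonglongrightarrow> scaleC c (u x h)"
      unfolding Dscale [OF x] by (rule bounded_linear.tendsto [OF bounded_linear_scaleC ulim [OF x]])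
  qed
  \<comment> \<open>Uniform convergence of the derivatives on the convex ball makes the limit
    differentiable. The function \<open>g'\<close> obtained is tied to \<open>g\<close> only on the
    ball, by uniqueness of limits.\<close>
  have "\<exists>g'. \<forall>x\<in>ball p r. (\<lambda>n. X n x) \<longlonglongrightarrow> g' x \<and> (g' has_derivative u x) (at x within ball p r)"
  proof (rule has_derivative_sequence)
    show "(X n has_derivative D n x) (at x within ball p r)" if "x \<in> ball p r" for n x
      using D [OF that] by (rule has_derivative_at_withinI)
    show "\<forall>\<^sub>F n in sequentially. \<forall>x\<in>ball p r. \<forall>h. norm (D n x h - u x h) \<le> e * norm h"
      if "e > 0" for e
      using uunif [OF that] by (simp add: eventually_sequentially)
    show "p \<in> ball p r"
      using \<open>r > 0\<close> by simp
  qed (use lim in auto)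
  then obtain g' where g': "\<And>x. x \<in> ball p r \<Longrightarrow> (\<lambda>n. X n x) \<longlonglongrightarrow> g' x"
      "\<And>x. x \<in> ball p r \<Longrightarrow> (g' has_derivative u x) (at x within ball p r)"
    by blast
  have g'_eq: "g' x = g x" if "x \<in> ball p r" for x
    using LIMSEQ_unique [OF g'(1) [OF that] lim] .
  \<comment> \<open>Openness of the ball permits both dropping the restriction to it and exchanging
    \<open>g'\<close> for \<open>g\<close>.\<close>
  have gderiv: "(g has_derivative u x) (at x)" if x: "x \<in> ball p r" for x
    using has_derivative_transform_within_open [of g' "u x" x UNIV "ball p r" g]
      g'(2) [OF x] g'_eq x by (simp add: at_within_open [OF x open_ball])
  have "\<exists>N. \<forall>n\<ge>N. Dp_bounded p r e (\<lambda>a. X n a - g a)" if "e > 0" for e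
  proof -
    obtain N1 where N1: "\<And>n a. n \<ge> N1 \<Longrightarrow> norm (X n a - g a) \<le> e"
      using unif [OF \<open>e > 0\<close>] by blast
    obtain N2 where N2: "\<And>n x h. n \<ge> N2 \<Longrightarrow> x \<in> ball p r \<Longrightarrow> norm (D n x h - u x h) \<le> e * norm h"
      using uunif [OF \<open>e > 0\<close>] by blast
    have "Dp_bounded p r e (\<lambda>a. X n a - g a)" if n: "n \<ge> max N1 N2" for n
      unfolding Dp_bounded_def
    proof (intro conjI allI ballI exI)
      show "continuous_on UNIV (\<lambda>a. X n a - g a)"
        by (intro continuous_on_diff cont cont_g)
      show "norm (X n a - g a) \<le> e" for a
        using N1 n by simp
      fix x assume x: "x \<in> ball p r"
      show "((\<lambda>a. X n a - g a) has_derivative (\<lambda>h. D n x h - u x h)) (at x)"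
        by (rule has_derivative_diff [OF D [OF x] gderiv [OF x]])
      show "D n x (scaleC c h) - u x (scaleC c h) = scaleC c (D n x h - u x h)" for c h
        by (simp add: Dscale [OF x] uscale [OF x] linear_diff [OF bounded_linear.linear [OF bounded_linear_scaleC]])
      show "norm (D n x h - u x h) \<le> e * norm h" for h
        using N2 n x by simp
    qed
    then show ?thesis
      by blast
  qed
  then show thesis
    by (rule that)
qed

section \<open>Verification of the axioms for \<open>Dp p r\<close>\<close>

theorem theorem4:
  fixes p :: "'a::banach_star_algebra" and r :: real
  assumes "star p = p" and "r > 0"
  shows "banach_star_algebra_on
           (Dp p r :: ('a \<Rightarrow> 'b::banach_star_algebra) set)
           (\<lambda>f g a. f a + g a)
           (\<lambda>a. 0)
           (\<lambda>c f a. scaleC c (f a))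
           (\<lambda>f g a. f a * g a)
           (\<lambda>f a. star (f (star a)))
           (Dp_norm p r)"
proof -
  let ?S = "Dp p r :: ('a \<Rightarrow> 'b) set"
  note iff = Dp_bounded_iff [OF \<open>r > 0\<close>, of p]
  have bdd: "Dp_bounded p r (Dp_norm p r f) f" if "f \<in> ?S" for f
    using that by (simp add: iff)
  have nonneg: "0 \<le> Dp_norm p r f" if "f \<in> ?S" for f
    using Dp_bounded_nonneg [OF bdd [OF that]] .
  note add = Dp_bounded_add [OF bdd bdd, unfolded iff]
    and scale = Dp_bounded_scaleC [OF bdd, unfolded iff]
    and star = Dp_bounded_star [OF bdd \<open>star p = p\<close>, unfolded iff]
    and zero = Dp_bounded_zero [of p r, unfolded iff]
  obtain K where K: "0 \<le> K" "\<And>x y :: 'b. norm (x * y) \<le> K * norm x * norm y"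
    by (rule norm_mult_bounded) blast
  note mult = Dp_bounded_mult [OF bdd bdd K, unfolded iff]
  show ?thesis
  proof
    fix f g h :: "'a \<Rightarrow> 'b" and c d
    show "f \<in> ?S \<Longrightarrow> \<exists>g\<in>?S. (\<lambda>a. f a + g a) = (\<lambda>a. 0)"
      using scale [of f "- 1"] by (intro bexI [of _ "\<lambda>a. scaleC (- 1) (f a)"])
        (auto simp: scaleC_minus_one)
    show "Dp_norm p r f = 0 \<longleftrightarrow> f = (\<lambda>a. 0)" if f: "f \<in> ?S"
    proof
      assume "Dp_norm p r f = 0"
      with bdd [OF f] show "f = (\<lambda>a. 0)"
        by (auto simp: Dp_bounded_def)
    next
      assume "f = (\<lambda>a. 0)"
      with zero nonneg [OF f] show "Dp_norm p r f = 0"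
        by (auto intro: antisym)
    qed
    show "Dp_norm p r (\<lambda>a. scaleC c (f a)) = cmod c * Dp_norm p r f" if f: "f \<in> ?S"
    proof (rule antisym)
      show "Dp_norm p r (\<lambda>a. scaleC c (f a)) \<le> cmod c * Dp_norm p r f"
        using scale [OF f] by blast
      show "cmod c * Dp_norm p r f \<le> Dp_norm p r (\<lambda>a. scaleC c (f a))"
      proof (cases "c = 0")
        case True
        then show ?thesis
          using nonneg scale [OF f] by simp
      next
        case False
        \<comment> \<open>The reverse inequality is the forward one applied to
          \<open>scaleC c (f a)\<close> with the scalar \<open>inverse c\<close>.\<close>
        have "Dp_norm p r (\<lambda>a. scaleC (inverse c) (scaleC c (f a)))
            \<le> cmod (inverse c) * Dp_norm p r (\<lambda>a. scaleC c (f a))"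
          using scale [of "\<lambda>a. scaleC c (f a)" "inverse c"] scale [OF f] by blast
        then show ?thesis
          using False by (simp add: star_algebra_simps norm_divide field_simps)
      qed
    qed
    show "Dp_norm p r (\<lambda>a. star (f (star a))) = Dp_norm p r f" if f: "f \<in> ?S"
    proof (rule antisym)
      show "Dp_norm p r (\<lambda>a. star (f (star a))) \<le> Dp_norm p r f"
        using star [OF f] by blast
      \<comment> \<open>The forward inequality for the adjoint function, whose own adjoint is
        \<open>f\<close>.\<close>
      show "Dp_norm p r f \<le> Dp_norm p r (\<lambda>a. star (f (star a)))"
        using star [of "\<lambda>a. star (f (star a))"] star [OF f] by (simp add: star_algebra_simps)
    qed
    show "\<exists>K. \<forall>f\<in>?S. \<forall>g\<in>?S. Dp_norm p r (\<lambda>a. f a * g a) \<le> K * Dp_norm p r f * Dp_norm p r g"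
      using mult by blast
  next
    fix X :: "nat \<Rightarrow> 'a \<Rightarrow> 'b"
    assume X: "\<And>n. X n \<in> ?S"
      and "\<And>e. e > 0 \<Longrightarrow> \<exists>N. \<forall>m\<ge>N. \<forall>n\<ge>N. Dp_norm p r (\<lambda>a. X m a + scaleC (- 1) (X n a)) < e"
    then have Cauchy: "\<exists>N. \<forall>m\<ge>N. \<forall>n\<ge>N. Dp_norm p r (\<lambda>a. X m a - X n a) < e" if "e > 0" for e
      using that by (simp add: scaleC_minus_one)
    have diff: "(\<lambda>a. f a - g a) \<in> ?S" if "f \<in> ?S" "g \<in> ?S" for f g
      using Dp_bounded_diff [OF bdd bdd] that by (simp add: iff)
    have Cauchy': "\<exists>N. \<forall>m\<ge>N. \<forall>n\<ge>N. Dp_bounded p r e (\<lambda>a. X m a - X n a)" if "e > 0" for e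
      using Cauchy [OF that] diff X unfolding iff by (meson less_imp_le)
    obtain g where g: "\<And>e. e > 0 \<Longrightarrow> \<exists>N. \<forall>n\<ge>N. Dp_bounded p r e (\<lambda>a. X n a - g a)"
      by (rule Dp_bounded_complete [OF \<open>r > 0\<close> X Cauchy']) (assumption | rule that)+
    show "\<exists>g\<in>?S. (\<lambda>n. Dp_norm p r (\<lambda>a. X n a + scaleC (- 1) (g a))) \<longlonglongrightarrow> 0"
    proof
      \<comment> \<open>The value 1 is arbitrary: one bounded difference shows \<open>g\<close> to
        be \<open>X N\<close> minus an element of the space.\<close>
      obtain N where "Dp_bounded p r 1 (\<lambda>a. X N a - g a)"
        using g [of 1] by auto
      then show gS: "g \<in> ?S"
        using diff [OF X, of "\<lambda>a. X N a - g a" N] by (simp add: iff)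
      show "(\<lambda>n. Dp_norm p r (\<lambda>a. X n a + scaleC (- 1) (g a))) \<longlonglongrightarrow> 0"
      proof (rule LIMSEQ_I)
        fix e :: real assume "e > 0"
        then obtain N where N: "\<And>n. n \<ge> N \<Longrightarrow> Dp_bounded p r (e / 2) (\<lambda>a. X n a - g a)"
          using g [of "e / 2"] by auto
        have "norm (Dp_norm p r (\<lambda>a. X n a + scaleC (- 1) (g a)) - 0) < e" if "n \<ge> N" for n
          using N [OF that] nonneg [OF diff [OF X gS], of n] \<open>e > 0\<close>
          by (simp add: iff scaleC_minus_one)
        then show "\<exists>N. \<forall>n\<ge>N. norm (Dp_norm p r (\<lambda>a. X n a + scaleC (- 1) (g a)) - 0) < e"
          by blast
      qed
    qed
  \<comment> \<open>What remains is closure, the triangle inequality and the algebraic identities,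
    which hold pointwise.\<close>
  qed (use add scale mult star zero in
      \<open>auto simp: star_algebra_simps algebra_simps fun_eq_iff\<close>)
qed

end
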